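(* Let $n\ge1$ and let $\Bbbk$ be a field. The Loewy length of $\Bbbk\,\mathcal{EO}_n$, and hence of $\Bbbk\,\mathcal{PO}_n$, is $n$.
   Context: $[n]=\{1,\dots,n\}$. $\mathcal{PO}_n$ is the monoid of all order-preserving partial functions on $[n]$ ($x\le y\Rightarrow f(x)\le f(y)$ for $x,y$ in the domain of $f$), and $\Bbbk\mathcal{PO}_n$ its monoid algebra. $\mathcal{EO}_n$ is the category whose objects are all subsets of $[n]$ and whose morphisms $A\to B$ are the order-preserving onto functions with domain $A$ and range $B$. The category algebra $\Bbbk\mathcal{EO}_n$ has basis the morphisms, with product $m'\cdot m=m'm$ if the composition is defined and $0$ otherwise. It is known that $\Bbbk\mathcal{PO}_n\simeq\Bbbk\mathcal{EO}_n$ as algebras. The Loewy length of a finite-dimensional algebra $A$ is the minimal integer $m$ with $\mathrm{Rad}^mA=0$. *)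

theory Defs
  imports "HOL-Algebra.Module" "HOL-Algebra.Ideal_Product" "HOL-Library.Poly_Mapping"
begin

section \<open>Radical and Loewy length of a (not necessarily commutative) ring\<close>

definition left_ideal :: "'a set \<Rightarrow> ('a, 'b) ring_scheme \<Rightarrow> bool" where
  "left_ideal I R \<longleftrightarrow>
     additive_subgroup I R \<and> (\<forall>a\<in>carrier R. \<forall>x\<in>I. a \<otimes>\<^bsub>R\<^esub> x \<in> I)"

definition maximal_left_ideal :: "'a set \<Rightarrow> ('a, 'b) ring_scheme \<Rightarrow> bool" where
  "maximal_left_ideal I R \<longleftrightarrow>
     left_ideal I R \<and> I \<noteq> carrier R \<and>
     (\<forall>J. left_ideal J R \<longrightarrow> I \<subseteq> J \<longrightarrow> J = I \<or> J = carrier R)"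

text \<open>
  Intersecting with the carrier only matters for the zero ring, which has no maximal left ideal.
\<close>

definition jacobson_radical :: "('a, 'b) ring_scheme \<Rightarrow> 'a set" where
  "jacobson_radical R = carrier R \<inter> \<Inter> {I. maximal_left_ideal I R}"

primrec ideal_power :: "('a, 'b) ring_scheme \<Rightarrow> 'a set \<Rightarrow> nat \<Rightarrow> 'a set" where
  "ideal_power R I 0 = carrier R"
| "ideal_power R I (Suc m) = ideal_prod R (ideal_power R I m) I"

text \<open>
  The least \<open>m\<close> with \<open>Rad\<^sup>m = 0\<close>; meaningful only if the radical is nilpotent, as it is for every
  finite-dimensional algebra.
\<close>

definition loewy_length :: "('a, 'b) ring_scheme \<Rightarrow> nat" where
  "loewy_length R = (LEAST m. ideal_power R (jacobson_radical R) m = {\<zero>\<^bsub>R\<^esub>})"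


section \<open>Monoid algebras\<close>

text \<open>
  Elements are finitely supported functions, \<open>single x c\<close> being the scalar multiple
  \<open>c x\<close> of the basis element \<open>x\<close>. Products are the bilinear extension of
  the product of basis elements.
\<close>

definition monoid_algebra ::
    "('m, 'z) monoid_scheme \<Rightarrow> ('k::field, 'm \<Rightarrow>\<^sub>0 'k) module" where
  "monoid_algebra M =
     \<lparr> carrier = {a. Poly_Mapping.keys a \<subseteq> carrier M},
       mult = (\<lambda>a b. \<Sum>x\<in>Poly_Mapping.keys a. \<Sum>y\<in>Poly_Mapping.keys b.
                 Poly_Mapping.single (x \<otimes>\<^bsub>M\<^esub> y) (Poly_Mapping.lookup a x * Poly_Mapping.lookup b y)),
       one = Poly_Mapping.single \<one>\<^bsub>M\<^esub> 1,
       zero = 0,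
       add = (+),
       smult = (\<lambda>c. Poly_Mapping.map ((*) c)) \<rparr>"


section \<open>Categories and category algebras\<close>

text \<open>
  \<open>Comp C g f\<close> is \<open>g\<close> after \<open>f\<close>; it is a total function whose value is only meaningful
  if the composition is defined, i.e. if \<open>composable C g f\<close>.
\<close>

record ('o, 'm) category =
  Obj :: "'o set"
  Hom :: "'o \<Rightarrow> 'o \<Rightarrow> 'm set"
  Comp :: "'m \<Rightarrow> 'm \<Rightarrow> 'm"
  Ident :: "'o \<Rightarrow> 'm"

definition Mor :: "('o, 'm) category \<Rightarrow> 'm set" where
  "Mor C = (\<Union>A\<in>Obj C. \<Union>B\<in>Obj C. Hom C A B)"

definition composable :: "('o, 'm) category \<Rightarrow> 'm \<Rightarrow> 'm \<Rightarrow> bool" where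
  "composable C g f \<longleftrightarrow>
     (\<exists>X\<in>Obj C. \<exists>Y\<in>Obj C. \<exists>Z\<in>Obj C. f \<in> Hom C X Y \<and> g \<in> Hom C Y Z)"

locale category =
  fixes C :: "('o, 'm) category"
  assumes Hom_disjoint:
      "\<lbrakk>A \<in> Obj C; B \<in> Obj C; A' \<in> Obj C; B' \<in> Obj C; f \<in> Hom C A B; f \<in> Hom C A' B'\<rbrakk>
       \<Longrightarrow> A = A' \<and> B = B'"
    and Comp_in_Hom:
      "\<lbrakk>X \<in> Obj C; Y \<in> Obj C; Z \<in> Obj C; f \<in> Hom C X Y; g \<in> Hom C Y Z\<rbrakk>
       \<Longrightarrow> Comp C g f \<in> Hom C X Z"
    and Comp_assoc:
      "\<lbrakk>W \<in> Obj C; X \<in> Obj C; Y \<in> Obj C; Z \<in> Obj C;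
        f \<in> Hom C W X; g \<in> Hom C X Y; h \<in> Hom C Y Z\<rbrakk>
       \<Longrightarrow> Comp C (Comp C h g) f = Comp C h (Comp C g f)"
    and Ident_in_Hom: "A \<in> Obj C \<Longrightarrow> Ident C A \<in> Hom C A A"
    and Comp_Ident:
      "\<lbrakk>A \<in> Obj C; B \<in> Obj C; f \<in> Hom C A B\<rbrakk> \<Longrightarrow> Comp C f (Ident C A) = f"
    and Ident_Comp:
      "\<lbrakk>A \<in> Obj C; B \<in> Obj C; f \<in> Hom C A B\<rbrakk> \<Longrightarrow> Comp C (Ident C B) f = f"

text \<open>
  The unit element is the sum of all identity morphisms, so \<open>category_algebra\<close> is intended for
  categories with finitely many objects.
\<close>

definition category_algebra ::
    "('o, 'm) category \<Rightarrow> ('k::field, 'm \<Rightarrow>\<^sub>0 'k) module" where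
  "category_algebra C =
     \<lparr> carrier = {a. Poly_Mapping.keys a \<subseteq> Mor C},
       mult = (\<lambda>a b. \<Sum>g\<in>Poly_Mapping.keys a. \<Sum>f\<in>Poly_Mapping.keys b.
                 if composable C g f
                 then Poly_Mapping.single (Comp C g f)
                        (Poly_Mapping.lookup a g * Poly_Mapping.lookup b f)
                 else 0),
       one = (\<Sum>A\<in>Obj C. Poly_Mapping.single (Ident C A) 1),
       zero = 0,
       add = (+),
       smult = (\<lambda>c. Poly_Mapping.map ((*) c)) \<rparr>"


section \<open>Order-preserving partial functions\<close>

definition order_preserving :: "(nat \<rightharpoonup> nat) \<Rightarrow> bool" where
  "order_preserving f \<longleftrightarrow> (\<forall>x\<in>dom f. \<forall>y\<in>dom f. x \<le> y \<longrightarrow> the (f x) \<le> the (f y))"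

definition PO :: "nat \<Rightarrow> (nat \<rightharpoonup> nat) monoid" where
  "PO n =
     \<lparr> carrier = {f. dom f \<subseteq> {1..n} \<and> ran f \<subseteq> {1..n} \<and> order_preserving f},
       mult = (\<circ>\<^sub>m),
       one = Some |` {1..n} \<rparr>"

definition EO :: "nat \<Rightarrow> (nat set, nat \<rightharpoonup> nat) category" where
  "EO n =
     \<lparr> Obj = Pow {1..n},
       Hom = (\<lambda>A B. {f. dom f = A \<and> ran f = B \<and> order_preserving f}),
       Comp = (\<circ>\<^sub>m),
       Ident = (\<lambda>A. Some |` A) \<rparr>"

lemma order_preserving_comp:
  assumes "order_preserving f" "order_preserving g"
  shows "order_preserving (g \<circ>\<^sub>m f)"
  unfolding order_preserving_def
proof (intro ballI impI)
  fix x y assume x: "x \<in> dom (g \<circ>\<^sub>m f)" and y: "y \<in> dom (g \<circ>\<^sub>m f)" and "x \<le> y"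
  obtain x1 x2 where 1: "f x = Some x1" "g x1 = Some x2"
    using x by (auto simp: map_comp_def split: option.splits)
  obtain y1 y2 where 2: "f y = Some y1" "g y1 = Some y2"
    using y by (auto simp: map_comp_def split: option.splits)
  have "x1 \<le> y1"
    using assms(1) \<open>x \<le> y\<close> 1 2 unfolding order_preserving_def by (metis domI option.sel)
  then have "x2 \<le> y2"
    using assms(2) 1 2 unfolding order_preserving_def by (metis domI option.sel)
  then show "the ((g \<circ>\<^sub>m f) x) \<le> the ((g \<circ>\<^sub>m f) y)"
    using 1 2 by simp
qed

lemma order_preserving_id: "order_preserving (Some |` A)"
  by (auto simp: order_preserving_def restrict_map_def)

lemma map_comp_assoc: "(h \<circ>\<^sub>m g) \<circ>\<^sub>m f = h \<circ>\<^sub>m (g \<circ>\<^sub>m f)"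
  by (rule ext) (auto simp: map_comp_def split: option.splits)

lemma map_comp_id_right: "dom f \<subseteq> A \<Longrightarrow> f \<circ>\<^sub>m (Some |` A) = f"
  by (rule ext) (simp add: map_comp_def restrict_map_def, metis domIff subsetD)

lemma map_comp_id_left: "ran f \<subseteq> A \<Longrightarrow> (Some |` A) \<circ>\<^sub>m f = f"
  by (rule ext) (auto simp: map_comp_def restrict_map_def ran_def split: option.splits)

lemma dom_id: "dom (Some |` A) = A"
  by (auto simp: restrict_map_def split: if_splits)

lemma ran_id: "ran (Some |` A) = A"
  by (auto simp: restrict_map_def ran_def)

lemma dom_comp_onto: "ran f = dom g \<Longrightarrow> dom (g \<circ>\<^sub>m f) = dom f"
  by (auto simp: map_comp_def ran_def dom_def split: option.splits)

lemma ran_comp_onto: "ran f = dom g \<Longrightarrow> ran (g \<circ>\<^sub>m f) = ran g"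
  by (fastforce simp: map_comp_def ran_def dom_def set_eq_iff split: option.splits)

lemma monoid_PO: "monoid (PO n)"
proof (rule monoidI)
  fix f g assume "f \<in> carrier (PO n)" "g \<in> carrier (PO n)"
  moreover have "dom (f \<circ>\<^sub>m g) \<subseteq> dom g" "ran (f \<circ>\<^sub>m g) \<subseteq> ran f"
    by (auto simp: map_comp_def ran_def split: option.splits)
  ultimately show "f \<otimes>\<^bsub>PO n\<^esub> g \<in> carrier (PO n)"
    unfolding PO_def using order_preserving_comp by simp (meson order_trans)
qed (auto simp: PO_def order_preserving_id dom_id ran_id map_comp_assoc
        map_comp_id_left map_comp_id_right)

lemma category_EO: "category (EO n)"
  by standard
    (auto simp: EO_def order_preserving_id order_preserving_comp dom_id ran_id map_comp_assoc
        map_comp_id_left map_comp_id_right dom_comp_onto ran_comp_onto)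

end

(*  A morphism of EO n strictly lowers the cardinality unless it is an isomorphism, and between two
    subsets of equal size there is exactly one isomorphism.  Hence the non-isomorphisms span a
    nilpotent left ideal, which lies in every maximal left ideal; conversely, for each object A the
    elements without isomorphisms of domain A in their support form a maximal left ideal, so the
    radical is exactly the span of the non-isomorphisms.  Its m-th power is supported on morphisms
    that lower the cardinality by at least m, which forces Rad^n = 0 as nonempty sets map onto
    nonempty sets, while the chain {1..n} -> ... -> {1,2} -> {1} shows that Rad^(n-1) is nonzero.
    The algebra of PO n is isomorphic to that of EO n by sending a partial function to the sum of
    all its restrictions, which is unitriangular with respect to inclusion of graphs.  *)
theory Submission
  imports Defs "HOL-Algebra.QuotRing"
begin

section \<open>Algebras spanned by a partial semigroup\<close>

text \<open>An element is the sum of its monomials, so linear statements reduce to basis elements.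
  Keeping supports inside \<open>S\<close> matters because associativity and unit laws are only
  available there.\<close>

lemma poly_mapping_induct_on [consumes 1, case_names zero single add]:
  assumes "Poly_Mapping.keys a \<subseteq> S"
    and "P 0"
    and "\<And>x c. x \<in> S \<Longrightarrow> P (Poly_Mapping.single x c)"
    and "\<And>a b. Poly_Mapping.keys a \<subseteq> S \<Longrightarrow> Poly_Mapping.keys b \<subseteq> S \<Longrightarrow> P a \<Longrightarrow> P b \<Longrightarrow> P (a + b)"
  shows "P (a :: 'a \<Rightarrow>\<^sub>0 'k::comm_monoid_add)"
proof -
  have *: "P (\<Sum>x\<in>X. Poly_Mapping.single x (g x)) \<and>
      Poly_Mapping.keys (\<Sum>x\<in>X. Poly_Mapping.single x (g x)) \<subseteq> S"
    if "finite X" "X \<subseteq> S" for X and g :: "'a \<Rightarrow> 'k"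
    using that
  proof (induction X rule: finite_induct)
    case (insert x X)
    then have "Poly_Mapping.keys (Poly_Mapping.single x (g x)) \<subseteq> S"
      by simp
    then show ?case
      using insert assms(3)[of x "g x"] assms(4) by (simp add: order.trans[OF keys_add])
  qed (simp add: assms(2))
  have "(\<Sum>x\<in>Poly_Mapping.keys a. Poly_Mapping.single x (Poly_Mapping.lookup a x)) = a"
    by (rule poly_mapping_eqI)
      (simp add: lookup_sum lookup_single when_def in_keys_iff)
  then show ?thesis
    using *[OF finite_keys assms(1), of "Poly_Mapping.lookup a"] by simp
qed

text \<open>A common form for both products: \<open>D\<close> constantly true gives a monoid
  algebra, and \<open>D\<close> as composability gives a category algebra, undefined products
  counting as 0.\<close>

definition conv ::
    "('a \<Rightarrow> 'a \<Rightarrow> bool) \<Rightarrow> ('a \<Rightarrow> 'a \<Rightarrow> 'a) \<Rightarrow> ('a \<Rightarrow>\<^sub>0 'k) \<Rightarrow> ('a \<Rightarrow>\<^sub>0 'k) \<Rightarrow> ('a \<Rightarrow>\<^sub>0 'k::field)" where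
  "conv D m a b = (\<Sum>x\<in>Poly_Mapping.keys a. \<Sum>y\<in>Poly_Mapping.keys b.
     if D x y then Poly_Mapping.single (m x y) (Poly_Mapping.lookup a x * Poly_Mapping.lookup b y) else 0)"

text \<open>Cancellation can make the support of \<open>a + b\<close> smaller than the union of the
  supports; this is harmless because the summand is additive in the coefficient and vanishes at
  coefficient 0.\<close>

lemma conv_add_left: "conv D m (a + b) c = conv D m a c + conv D m b c"
  unfolding conv_def
  by (rule setsum_keys_plus_distrib)
    (auto simp: distrib_right single_add simp flip: sum.distrib intro!: sum.cong sum.neutral)

lemma conv_add_right: "conv D m a (b + c) = conv D m a b + conv D m a c"
  unfolding conv_def sum.distrib[symmetric]
  by (rule sum.cong[OF refl], rule setsum_keys_plus_distrib) (auto simp: distrib_left single_add)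

lemma conv_zero [simp]: "conv D m 0 a = 0" "conv D m a 0 = 0"
  by (simp_all add: conv_def)

lemma conv_single [simp]:
  "conv D m (Poly_Mapping.single x c) (Poly_Mapping.single y d) =
     (if D x y then Poly_Mapping.single (m x y) (c * d) else 0)"
  by (simp add: conv_def)

lemma conv_sum_left: "conv D m (\<Sum>i\<in>I. f i) a = (\<Sum>i\<in>I. conv D m (f i) a)"
  by (induction I rule: infinite_finite_induct) (auto simp: conv_add_left)

lemma conv_sum_right: "conv D m a (\<Sum>i\<in>I. f i) = (\<Sum>i\<in>I. conv D m a (f i))"
  by (induction I rule: infinite_finite_induct) (auto simp: conv_add_right)

lemma keys_conv:
  "Poly_Mapping.keys (conv D m a b) \<subseteq>
     {m x y | x y. x \<in> Poly_Mapping.keys a \<and> y \<in> Poly_Mapping.keys b \<and> D x y}"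
proof
  fix z assume "z \<in> Poly_Mapping.keys (conv D m a b)"
  then obtain x where x: "x \<in> Poly_Mapping.keys a" "z \<in> Poly_Mapping.keys (\<Sum>y\<in>Poly_Mapping.keys b.
     if D x y then Poly_Mapping.single (m x y) (Poly_Mapping.lookup a x * Poly_Mapping.lookup b y) else 0)"
    unfolding conv_def using keys_sum by fastforce
  then obtain y where y: "y \<in> Poly_Mapping.keys b" "z \<in> Poly_Mapping.keys (
     if D x y then Poly_Mapping.single (m x y) (Poly_Mapping.lookup a x * Poly_Mapping.lookup b y) else 0)"
    using keys_sum by fastforce
  then show "z \<in> {m x y | x y. x \<in> Poly_Mapping.keys a \<and> y \<in> Poly_Mapping.keys b \<and> D x y}"
    using x(1) by (auto split: if_splits)
qed

lemma lookup_conv: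
  "Poly_Mapping.lookup (conv D m a b) z =
     (\<Sum>x\<in>Poly_Mapping.keys a. \<Sum>y\<in>Poly_Mapping.keys b.
        if D x y \<and> m x y = z then Poly_Mapping.lookup a x * Poly_Mapping.lookup b y else 0)"
  unfolding conv_def lookup_sum by (intro sum.cong refl) (auto simp: lookup_single)

lemma lookup_conv_single_left:
  "Poly_Mapping.lookup (conv D m (Poly_Mapping.single x c) b) z =
     (\<Sum>y\<in>Poly_Mapping.keys b. if D x y \<and> m x y = z then c * Poly_Mapping.lookup b y else 0)"
  \<comment> \<open>\<open>single x 0\<close> has empty support, so the sum over its keys has a term
    only for \<open>c\<close> nonzero.\<close>
  by (cases "c = 0") (simp_all add: lookup_conv cong: if_cong)

lemma lookup_conv_single_right:
  "Poly_Mapping.lookup (conv D m a (Poly_Mapping.single y c)) z =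
     (\<Sum>x\<in>Poly_Mapping.keys a. if D x y \<and> m x y = z then Poly_Mapping.lookup a x * c else 0)"
  by (cases "c = 0") (simp_all add: lookup_conv cong: if_cong)

text \<open>Assumption \<open>dom\<close> makes the two bracketings of a triple product defined or
  undefined together, so associativity holds for basis elements even where products are set to 0;
  bilinearity does the rest.\<close>

lemma ring_conv:
  fixes R :: "('a \<Rightarrow>\<^sub>0 'k::field, 'z) ring_scheme"
  assumes carrier: "carrier R = {a. Poly_Mapping.keys a \<subseteq> S}"
    and mult: "mult R = conv D m" and zero: "zero R = 0" and add: "add R = (+)"
    and one: "one R \<in> carrier R"
    and closed: "\<And>x y. x \<in> S \<Longrightarrow> y \<in> S \<Longrightarrow> D x y \<Longrightarrow> m x y \<in> S"
    and dom: "\<And>x y z. x \<in> S \<Longrightarrow> y \<in> S \<Longrightarrow> z \<in> S \<Longrightarrow> D x y \<and> D (m x y) z \<longleftrightarrow> D y z \<and> D x (m y z)"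
    and assoc: "\<And>x y z. x \<in> S \<Longrightarrow> y \<in> S \<Longrightarrow> z \<in> S \<Longrightarrow> D x y \<Longrightarrow> D y z \<Longrightarrow> m (m x y) z = m x (m y z)"
    and unit_left: "\<And>x c. x \<in> S \<Longrightarrow> conv D m (one R) (Poly_Mapping.single x c) = Poly_Mapping.single x c"
    and unit_right: "\<And>x c. x \<in> S \<Longrightarrow> conv D m (Poly_Mapping.single x c) (one R) = Poly_Mapping.single x c"
  shows "ring R"
proof (rule ringI)
  show "abelian_group R"
  proof (rule abelian_groupI)
    fix a assume "a \<in> carrier R"
    then show "\<exists>b\<in>carrier R. b \<oplus>\<^bsub>R\<^esub> a = \<zero>\<^bsub>R\<^esub>"
      by (intro bexI[of _ "- a"]) (simp_all add: carrier add zero in_keys_iff subset_iff)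
  qed (auto simp: carrier add zero add_ac dest!: subsetD[OF keys_add])
  show "monoid R"
  proof (rule monoidI)
    fix a b c assume "a \<in> carrier R" "b \<in> carrier R" "c \<in> carrier R"
    then have abc: "Poly_Mapping.keys a \<subseteq> S" "Poly_Mapping.keys b \<subseteq> S" "Poly_Mapping.keys c \<subseteq> S"
      by (auto simp: carrier)
    show "a \<otimes>\<^bsub>R\<^esub> b \<in> carrier R"
      using abc closed by (fastforce simp: carrier mult dest!: subsetD[OF keys_conv])
    \<comment> \<open>Associativity is extended from basis elements one argument at a time: first in
      \<open>c\<close>, then in \<open>b\<close>, finally in \<open>a\<close>.\<close>
    have 1: "conv D m (conv D m (Poly_Mapping.single x r) (Poly_Mapping.single y s)) c =
      conv D m (Poly_Mapping.single x r) (conv D m (Poly_Mapping.single y s) c)"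
      if "x \<in> S" "y \<in> S" for x y r s
      using abc(3)
    proof (induction c rule: poly_mapping_induct_on)
      case (single z t)
      then show ?case using that dom[of x y z] assoc[of x y z] by (auto simp: mult_ac)
    qed (simp_all add: conv_add_right)
    have 2: "conv D m (conv D m (Poly_Mapping.single x r) b) c =
      conv D m (Poly_Mapping.single x r) (conv D m b c)" if "x \<in> S" for x r
      using abc(2) by (induction b rule: poly_mapping_induct_on)
        (simp_all only: conv_add_right conv_add_left conv_zero 1[OF that])
    show "(a \<otimes>\<^bsub>R\<^esub> b) \<otimes>\<^bsub>R\<^esub> c = a \<otimes>\<^bsub>R\<^esub> (b \<otimes>\<^bsub>R\<^esub> c)"
      unfolding mult using abc(1) by (induction a rule: poly_mapping_induct_on)
        (simp_all only: conv_add_right conv_add_left conv_zero 2)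
    show "\<one>\<^bsub>R\<^esub> \<otimes>\<^bsub>R\<^esub> a = a" unfolding mult
      using abc(1) by (induction a rule: poly_mapping_induct_on)
        (simp_all only: conv_add_right conv_zero unit_left)
    show "a \<otimes>\<^bsub>R\<^esub> \<one>\<^bsub>R\<^esub> = a" unfolding mult
      using abc(1) by (induction a rule: poly_mapping_induct_on)
        (simp_all only: conv_add_left conv_zero unit_right)
  qed (rule one)
qed (simp_all add: mult add conv_add_left conv_add_right)

section \<open>Monoid algebras and category algebras as rings\<close>

lemma monoid_algebra_simps:
  "carrier (monoid_algebra M) = {a. Poly_Mapping.keys a \<subseteq> carrier M}"
  "mult (monoid_algebra M) = conv (\<lambda>_ _. True) (mult M)"
  "one (monoid_algebra M) = Poly_Mapping.single \<one>\<^bsub>M\<^esub> 1"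
  "zero (monoid_algebra M) = 0"
  "add (monoid_algebra M) = (+)"
  by (simp_all add: monoid_algebra_def conv_def fun_eq_iff)

lemma category_algebra_simps:
  "carrier (category_algebra C) = {a. Poly_Mapping.keys a \<subseteq> Mor C}"
  "mult (category_algebra C) = conv (composable C) (Comp C)"
  "one (category_algebra C) = (\<Sum>A\<in>Obj C. Poly_Mapping.single (Ident C A) 1)"
  "zero (category_algebra C) = 0"
  "add (category_algebra C) = (+)"
  by (simp_all add: category_algebra_def conv_def fun_eq_iff)

lemma ring_monoid_algebra:
  assumes "monoid M"
  shows "ring (monoid_algebra M :: ('k::field, _ \<Rightarrow>\<^sub>0 'k) module)"
proof -
  interpret M: monoid M by fact
  show ?thesis
    by (rule ring_conv[where S = "carrier M" and D = "\<lambda>_ _. True" and m = "mult M"])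
      (simp_all add: monoid_algebra_simps M.m_assoc)
qed

context category
begin

text \<open>Disjointness of the hom-sets makes source and target of a morphism unique, which removes
  the existential quantifiers from \<open>composable\<close>.\<close>

lemma composable_iff:
  assumes "X \<in> Obj C" "Y \<in> Obj C" "Y' \<in> Obj C" "Z \<in> Obj C" "f \<in> Hom C X Y" "g \<in> Hom C Y' Z"
  shows "composable C g f \<longleftrightarrow> Y = Y'"
  using assms Hom_disjoint unfolding composable_def by metis

lemma MorE:
  assumes "f \<in> Mor C"
  obtains X Y where "X \<in> Obj C" "Y \<in> Obj C" "f \<in> Hom C X Y"
  using assms by (auto simp: Mor_def)

lemma ring_category_algebra:
  assumes "finite (Obj C)"
  shows "ring (category_algebra C :: ('k::field, _ \<Rightarrow>\<^sub>0 'k) module)"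
proof (rule ring_conv[where S = "Mor C"])
  have "Poly_Mapping.keys (\<Sum>A\<in>Obj C. Poly_Mapping.single (Ident C A) (1::'k)) \<subseteq> Mor C"
    using Ident_in_Hom by (fastforce simp: Mor_def dest!: subsetD[OF keys_sum])
  then show "\<one>\<^bsub>category_algebra C\<^esub> \<in> carrier (category_algebra C :: ('k, _ \<Rightarrow>\<^sub>0 'k) module)"
    by (simp add: category_algebra_simps)
  fix x y z assume xyz: "x \<in> Mor C" "y \<in> Mor C" "z \<in> Mor C"
  obtain A A' where x: "A \<in> Obj C" "A' \<in> Obj C" "x \<in> Hom C A A'" using xyz(1) by (rule MorE)
  obtain B B' where y: "B \<in> Obj C" "B' \<in> Obj C" "y \<in> Hom C B B'" using xyz(2) by (rule MorE)
  obtain E E' where z: "E \<in> Obj C" "E' \<in> Obj C" "z \<in> Hom C E E'" using xyz(3) by (rule MorE)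
  have xy: "composable C x y \<longleftrightarrow> B' = A" using x y by (intro composable_iff)
  have yz: "composable C y z \<longleftrightarrow> E' = B" using y z by (intro composable_iff)
  have cxy: "Comp C x y \<in> Hom C B A'" if "composable C x y"
    using that xy x y Comp_in_Hom by metis
  have cyz: "Comp C y z \<in> Hom C E B'" if "composable C y z"
    using that yz y z Comp_in_Hom by metis
  show "composable C x y \<and> composable C (Comp C x y) z \<longleftrightarrow>
      composable C y z \<and> composable C x (Comp C y z)"
    using x y z xy yz cxy cyz composable_iff by metis
  show "Comp C (Comp C x y) z = Comp C x (Comp C y z)" if "composable C x y" "composable C y z"
    using that x y z xy yz Comp_assoc by metis
next
  fix x y assume "composable C x y"
  then obtain X Y Z where "X \<in> Obj C" "Z \<in> Obj C" "Comp C x y \<in> Hom C X Z"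
    unfolding composable_def using Comp_in_Hom by metis
  then show "Comp C x y \<in> Mor C"
    unfolding Mor_def by blast
next
  fix x and c :: 'k assume "x \<in> Mor C"
  then obtain A B where x: "A \<in> Obj C" "B \<in> Obj C" "x \<in> Hom C A B" by (rule MorE)
  \<comment> \<open>Of all the identities in the sum, only the one at the target of \<open>x\<close>
    composes with \<open>x\<close> from the left; below, only the one at its source does so from the
    right. Finiteness of \<open>Obj C\<close> makes the sum an honest one.\<close>
  have "composable C (Ident C X) x \<longleftrightarrow> X = B" if "X \<in> Obj C" for X
    using composable_iff[OF x(1,2) that that x(3) Ident_in_Hom[OF that]] by auto
  then have "conv (composable C) (Comp C) \<one>\<^bsub>category_algebra C\<^esub> (Poly_Mapping.single x c) =
      (\<Sum>X\<in>Obj C. if X = B then Poly_Mapping.single x c else 0)"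
    using x Ident_Comp by (auto simp: category_algebra_simps conv_sum_left intro!: sum.cong)
  also have "\<dots> = Poly_Mapping.single x c"
    using x assms by simp
  finally show "conv (composable C) (Comp C) \<one>\<^bsub>category_algebra C\<^esub> (Poly_Mapping.single x c) =
      Poly_Mapping.single x c" .
  have "composable C x (Ident C X) \<longleftrightarrow> X = A" if "X \<in> Obj C" for X
    using composable_iff[OF that that x(1,2) Ident_in_Hom[OF that] x(3)] by auto
  then have "conv (composable C) (Comp C) (Poly_Mapping.single x c) \<one>\<^bsub>category_algebra C\<^esub> =
      (\<Sum>X\<in>Obj C. if X = A then Poly_Mapping.single x c else 0)"
    using x Comp_Ident by (auto simp: category_algebra_simps conv_sum_right intro!: sum.cong)
  also have "\<dots> = Poly_Mapping.single x c"
    using x assms by simp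
  finally show "conv (composable C) (Comp C) (Poly_Mapping.single x c) \<one>\<^bsub>category_algebra C\<^esub> =
      Poly_Mapping.single x c" .
qed (simp_all add: category_algebra_simps)

end

section \<open>Invariance of the Loewy length under ring isomorphisms\<close>

locale ring_isomorphism =
  fixes R :: "('a, 'c) ring_scheme" and S :: "('b, 'd) ring_scheme" and h
  assumes ring_R: "ring R" and ring_S: "ring S" and iso: "h \<in> ring_iso R S"
begin

sublocale R: ring R by (rule ring_R)

sublocale S: ring S by (rule ring_S)

sublocale ring_hom_ring R S h
  using ring_R ring_S iso by (intro ring_hom_ringI2) (auto simp: ring_iso_def)

abbreviation "g \<equiv> inv_into (carrier R) h"

text \<open>This symmetry lets each inclusion proved for \<open>h\<close> be applied to
  \<open>g\<close> as well, which yields the reverse inclusion.\<close>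

lemma inverse: "ring_isomorphism S R g"
  using ring_R ring_S iso by (simp add: ring_iso_set_sym ring_isomorphism_def)

lemma bij: "bij_betw h (carrier R) (carrier S)"
  using ring_iso_memE(5)[OF iso] .

lemma image_carrier: "h ` carrier R = carrier S"
  using bij by (simp add: bij_betw_def)

lemma image_inverse: "J \<subseteq> carrier S \<Longrightarrow> h ` g ` J = J"
  using bij by (simp add: bij_betw_def image_inv_into_cancel)

lemma inverse_image: "I \<subseteq> carrier R \<Longrightarrow> g ` h ` I = I"
  using bij by (simp add: bij_betw_def inv_into_image_cancel)

lemma left_ideal_image:
  assumes "left_ideal I R"
  shows "left_ideal (h ` I) S"
  unfolding left_ideal_def
proof (intro conjI ballI)
  have I: "additive_subgroup I R" and mult: "\<And>a x. a \<in> carrier R \<Longrightarrow> x \<in> I \<Longrightarrow> a \<otimes>\<^bsub>R\<^esub> x \<in> I"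
    using assms by (auto simp: left_ideal_def)
  note I_sub = additive_subgroup.a_subset[OF I]
  show "additive_subgroup (h ` I) S"
    using group_hom.subgroup_img_is_subgroup[OF a_group_hom additive_subgroup.a_subgroup[OF I]]
    by (rule additive_subgroup.intro)
  fix a x assume "a \<in> carrier S" "x \<in> h ` I"
  then obtain b y where "b \<in> carrier R" "a = h b" "y \<in> I" "x = h y"
    using image_carrier by blast
  then show "a \<otimes>\<^bsub>S\<^esub> x \<in> h ` I"
    using mult I_sub hom_mult by (metis imageI subsetD)
qed

lemma maximal_left_ideal_image:
  assumes "maximal_left_ideal I R"
  shows "maximal_left_ideal (h ` I) S"
  unfolding maximal_left_ideal_def
proof (intro conjI allI impI)
  have I: "left_ideal I R" "I \<noteq> carrier R"
    and max: "\<And>J. left_ideal J R \<Longrightarrow> I \<subseteq> J \<Longrightarrow> J = I \<or> J = carrier R"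
    using assms by (auto simp: maximal_left_ideal_def)
  have I_sub: "I \<subseteq> carrier R"
    using I(1) by (simp add: left_ideal_def additive_subgroup.a_subset)
  show "left_ideal (h ` I) S" using left_ideal_image[OF I(1)] .
  show "h ` I \<noteq> carrier S" using I inverse_image I_sub image_carrier by (metis order_refl)
  fix J assume J: "left_ideal J S" "h ` I \<subseteq> J"
  have J_sub: "J \<subseteq> carrier S"
    using J(1) by (simp add: left_ideal_def additive_subgroup.a_subset)
  have "I \<subseteq> g ` J" using inverse_image[OF I_sub] J(2) by blast
  then have "g ` J = I \<or> g ` J = carrier R"
    using max ring_isomorphism.left_ideal_image[OF inverse J(1)] by blast
  then show "J = h ` I \<or> J = carrier S"
    using image_inverse[OF J_sub] image_carrier by metis
qed

lemma ideal_prod_image_subset: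
  assumes "I \<subseteq> carrier R" "J \<subseteq> carrier R"
  shows "ideal_prod R I J \<subseteq> carrier R" "h ` ideal_prod R I J \<subseteq> ideal_prod S (h ` I) (h ` J)"
proof -
  have "x \<in> carrier R \<and> h x \<in> ideal_prod S (h ` I) (h ` J)" if "x \<in> ideal_prod R I J" for x
    using that
  proof induction
    case (prod i j)
    then have "i \<in> carrier R" "j \<in> carrier R" using assms by auto
    then show ?case using prod by (auto intro: ideal_prod.prod)
  next
    case (sum a b)
    then show ?case by (auto intro: ideal_prod.sum)
  qed
  then show "ideal_prod R I J \<subseteq> carrier R" "h ` ideal_prod R I J \<subseteq> ideal_prod S (h ` I) (h ` J)"
    by auto
qed

lemma jacobson_radical_image_subset: "h ` jacobson_radical R \<subseteq> jacobson_radical S"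
proof
  fix y assume "y \<in> h ` jacobson_radical R"
  then obtain x where x: "x \<in> jacobson_radical R" "y = h x" by blast
  then have xc: "x \<in> carrier R" by (simp add: jacobson_radical_def)
  have "y \<in> M" if M: "maximal_left_ideal M S" for M
  proof -
    have "x \<in> g ` M"
      using x ring_isomorphism.maximal_left_ideal_image[OF inverse M]
      by (simp add: jacobson_radical_def)
    moreover have "M \<subseteq> carrier S"
      using M by (simp add: maximal_left_ideal_def left_ideal_def additive_subgroup.a_subset)
    ultimately show ?thesis using image_inverse x by blast
  qed
  then show "y \<in> jacobson_radical S"
    using xc x by (simp add: jacobson_radical_def)
qed

end

context ring_isomorphism
begin

lemma jacobson_radical_image: "h ` jacobson_radical R = jacobson_radical S"
proof
  have "g ` jacobson_radical S \<subseteq> jacobson_radical R"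
    using ring_isomorphism.jacobson_radical_image_subset[OF inverse] .
  moreover have "jacobson_radical S \<subseteq> carrier S"
    by (auto simp: jacobson_radical_def)
  ultimately show "jacobson_radical S \<subseteq> h ` jacobson_radical R"
    using image_inverse by (metis image_mono)
qed (rule jacobson_radical_image_subset)

lemma ideal_prod_image:
  assumes "I \<subseteq> carrier R" "J \<subseteq> carrier R"
  shows "h ` ideal_prod R I J = ideal_prod S (h ` I) (h ` J)"
proof
  interpret inv: ring_isomorphism S R g by (rule inverse)
  have sub: "h ` I \<subseteq> carrier S" "h ` J \<subseteq> carrier S"
    using assms image_carrier by auto
  have "g ` ideal_prod S (h ` I) (h ` J) \<subseteq> ideal_prod R I J"
    using inv.ideal_prod_image_subset(2)[OF sub] inverse_image assms by simp
  then show "ideal_prod S (h ` I) (h ` J) \<subseteq> h ` ideal_prod R I J"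
    using image_inverse[OF inv.ideal_prod_image_subset(1)[OF sub]] by (metis image_mono)
qed (rule ideal_prod_image_subset(2)[OF assms])

lemma ideal_power_image:
  assumes "I \<subseteq> carrier R"
  shows "ideal_power R I m \<subseteq> carrier R \<and> h ` ideal_power R I m = ideal_power S (h ` I) m"
proof (induction m)
  case (Suc m)
  then show ?case
    using assms ideal_prod_image ideal_prod_image_subset(1) by simp
qed (simp add: image_carrier)

text \<open>The powers of the two radicals vanish for the same exponents, so the two
  \<open>LEAST\<close> terms agree without any appeal to nilpotency.\<close>

lemma loewy_length_eq: "loewy_length R = loewy_length S"
proof -
  let ?I = "jacobson_radical R" and ?J = "jacobson_radical S"
  have sub: "?I \<subseteq> carrier R" by (auto simp: jacobson_radical_def)
  have "ideal_power R ?I m = {\<zero>\<^bsub>R\<^esub>} \<longleftrightarrow> ideal_power S ?J m = {\<zero>\<^bsub>S\<^esub>}" for m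
  proof -
    have "ideal_power R ?I m \<subseteq> carrier R" "h ` ideal_power R ?I m = ideal_power S ?J m"
      using ideal_power_image[OF sub] jacobson_radical_image by auto
    moreover have "h ` {\<zero>\<^bsub>R\<^esub>} = {\<zero>\<^bsub>S\<^esub>}" by simp
    ultimately show ?thesis
      using inverse_image[of "ideal_power R ?I m"] inverse_image[of "{\<zero>\<^bsub>R\<^esub>}"] by force
  qed
  then show ?thesis by (simp add: loewy_length_def)
qed

end

section \<open>Nilpotent left ideals\<close>

context ring
begin

text \<open>Otherwise \<open>M + N\<close> is the whole ring, so 1 = u + y with \<open>u\<close> in
  \<open>M\<close> and \<open>y\<close> in \<open>N\<close>. Feeding the equation into itself puts 1
  into \<open>M + y^j\<close> for every \<open>j\<close>, and \<open>y^k = 0\<close> then gives the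
  contradiction that 1 lies in \<open>M\<close>.\<close>

lemma nilpotent_left_ideal_subset_maximal:
  assumes N: "left_ideal N R" and nil: "ideal_power R N k = {\<zero>}" and M: "maximal_left_ideal M R"
  shows "N \<subseteq> M"
proof (rule ccontr)
  assume "\<not> N \<subseteq> M"
  then obtain x where x: "x \<in> N" "x \<notin> M" by blast
  have lM: "left_ideal M R" and "M \<noteq> carrier R"
    and max: "\<And>J. left_ideal J R \<Longrightarrow> M \<subseteq> J \<Longrightarrow> J = M \<or> J = carrier R"
    using M by (auto simp: maximal_left_ideal_def)
  interpret M: additive_subgroup M R using lM by (simp add: left_ideal_def)
  interpret N: additive_subgroup N R using N by (simp add: left_ideal_def)
  have multM: "\<And>a x. a \<in> carrier R \<Longrightarrow> x \<in> M \<Longrightarrow> a \<otimes> x \<in> M"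
    and multN: "\<And>a x. a \<in> carrier R \<Longrightarrow> x \<in> N \<Longrightarrow> a \<otimes> x \<in> N"
    using lM N by (auto simp: left_ideal_def)
  have sum_mem: "u \<oplus> v \<in> set_add R M N" if "u \<in> M" "v \<in> N" for u v
    using that by (auto simp: set_add_def')
  have "left_ideal (set_add R M N) R"
    unfolding left_ideal_def
  proof (intro conjI ballI)
    show "additive_subgroup (set_add R M N) R"
      by (rule add_additive_subgroups) unfold_locales
    fix a z assume a: "a \<in> carrier R" and "z \<in> set_add R M N"
    then obtain u v where "u \<in> M" "v \<in> N" "z = u \<oplus> v" by (auto simp: set_add_def')
    then show "a \<otimes> z \<in> set_add R M N"
      using a sum_mem[OF multM[OF a] multN[OF a]] M.a_Hcarr N.a_Hcarr by (simp add: r_distr)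
  qed
  moreover have "M \<subseteq> set_add R M N"
  proof
    fix u assume "u \<in> M"
    then show "u \<in> set_add R M N" using sum_mem[of u \<zero>] M.a_Hcarr by simp
  qed
  moreover have "x \<in> set_add R M N"
    using x(1) sum_mem[of \<zero> x] N.a_Hcarr by simp
  ultimately have "\<one> \<in> set_add R M N"
    using max x(2) one_closed by metis
  then obtain u y where u: "u \<in> M" and y: "y \<in> N" and one: "\<one> = u \<oplus> y"
    by (auto simp: set_add_def')
  have carr: "u \<in> carrier R" "y \<in> carrier R"
    using u y M.a_Hcarr N.a_Hcarr by auto
  have "\<exists>v\<in>M. \<one> = v \<oplus> y [^] (j::nat)" for j
  proof (induction j)
    case 0
    show ?case by (intro bexI[of _ \<zero>]) auto
  next
    case (Suc j)
    then obtain v where v: "v \<in> M" "\<one> = v \<oplus> y [^] j" by blast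
    \<comment> \<open>The factor 1 behind \<open>y\<close> is replaced by the decomposition for
      \<open>j\<close>; the term \<open>y \<otimes> v\<close> is absorbed by \<open>M\<close>, a
      left ideal.\<close>
    have "\<one> = u \<oplus> y \<otimes> \<one>"
      unfolding r_one[OF carr(2)] by (rule one)
    also have "\<dots> = u \<oplus> y \<otimes> (v \<oplus> y [^] j)"
      by (simp only: flip: v(2))
    also have "\<dots> = (u \<oplus> y \<otimes> v) \<oplus> y [^] Suc j"
      using carr v(1) M.a_Hcarr nat_pow_Suc2[OF carr(2), of j] by (simp add: r_distr a_assoc)
    finally show ?case
      using u multM[OF carr(2) v(1)] by (intro bexI[of _ "u \<oplus> y \<otimes> v"]) auto
  qed
  moreover have "y [^] j \<in> ideal_power R N j" for j :: nat
    by (induction j) (auto intro: ideal_prod.prod y)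
  ultimately have "\<one> \<in> M"
    using nil M.a_Hcarr by (metis r_zero singletonD)
  then have "carrier R \<subseteq> M"
    using multM by (metis r_one subsetI)
  then show False
    using \<open>M \<noteq> carrier R\<close> M.a_subset by blast
qed

text \<open>\<open>ideal_prod\<close> is generated by products and sums only, so zero has to be
  exhibited as a product of zeros. This turns inclusions into the zero set into equalities.\<close>

lemma zero_in_ideal_power:
  assumes "\<zero> \<in> I"
  shows "\<zero> \<in> ideal_power R I m"
proof (induction m)
  case (Suc m)
  then show ?case using ideal_prod.prod[of \<zero> _ \<zero> I R] assms by simp
qed simp

end

section \<open>The radical of the algebra of \<open>EO n\<close>\<close>

abbreviation span_on :: "'a set \<Rightarrow> ('a \<Rightarrow>\<^sub>0 'k::zero) set" where
  "span_on T \<equiv> {a. Poly_Mapping.keys a \<subseteq> T}"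

lemma keys_diff_subset:
  fixes a b :: "'a \<Rightarrow>\<^sub>0 'k::ab_group_add"
  assumes "Poly_Mapping.keys a \<subseteq> T" "Poly_Mapping.keys b \<subseteq> T"
  shows "Poly_Mapping.keys (a - b) \<subseteq> T"
  using keys_diff[of a b] assms by blast

lemma additive_subgroup_span_on:
  fixes R :: "('a \<Rightarrow>\<^sub>0 'k::field, 'z) ring_scheme"
  assumes "ring R" "zero R = 0" "add R = (+)" "span_on T \<subseteq> carrier R"
  shows "additive_subgroup (span_on T) R"
proof (rule additive_subgroup.intro, rule group.subgroupI)
  interpret ring R by fact
  show "group (add_monoid R)" by (rule a_group)
  show "span_on T \<subseteq> carrier (add_monoid R)" using assms by simp
  have "(0 :: 'a \<Rightarrow>\<^sub>0 'k) \<in> span_on T" by simp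
  then show "span_on T \<noteq> ({} :: ('a \<Rightarrow>\<^sub>0 'k) set)" by blast
  fix a :: "'a \<Rightarrow>\<^sub>0 'k" assume a: "a \<in> span_on T"
  then have "- a \<in> span_on T" by (simp add: subset_iff in_keys_iff)
  moreover from this have "\<ominus>\<^bsub>R\<^esub> a = - a"
    using a assms(2,3) subsetD[OF assms(4)] by (intro minus_equality) auto
  ultimately show "inv\<^bsub>add_monoid R\<^esub> a \<in> span_on T" by (simp add: a_inv_def)
  fix b :: "'a \<Rightarrow>\<^sub>0 'k" assume "b \<in> span_on T"
  then show "a \<otimes>\<^bsub>add_monoid R\<^esub> b \<in> span_on T"
    using a assms(3) keys_add[of a b] by auto
qed

section \<open>Morphisms of \<open>EO n\<close>: cardinalities and invertibility\<close>

lemma EO_simps [simp]: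
  "Obj (EO n) = Pow {1..n}"
  "Hom (EO n) A B = {f. dom f = A \<and> ran f = B \<and> order_preserving f}"
  "Comp (EO n) = (\<circ>\<^sub>m)"
  "Ident (EO n) A = Some |` A"
  by (simp_all add: EO_def)

text \<open>Every partial function is onto its own range, so the union of the hom-sets is exactly
  the underlying set of \<open>PO n\<close>.\<close>

lemma Mor_EO: "Mor (EO n) = {f. dom f \<subseteq> {1..n} \<and> ran f \<subseteq> {1..n} \<and> order_preserving f}"
  by (auto simp: Mor_def)

lemma composable_EO:
  "composable (EO n) g f \<longleftrightarrow> g \<in> Mor (EO n) \<and> f \<in> Mor (EO n) \<and> ran f = dom g"
  by (auto simp: composable_def Mor_EO)

lemma comp_in_Mor_EO:
  assumes "g \<in> Mor (EO n)" "f \<in> Mor (EO n)" "ran f = dom g"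
  shows "g \<circ>\<^sub>m f \<in> Mor (EO n)"
  using assms by (auto simp: Mor_EO order_preserving_comp dom_comp_onto ran_comp_onto)

lemma Ident_in_Mor_EO: "A \<subseteq> {1..n} \<Longrightarrow> Some |` A \<in> Mor (EO n)"
  by (simp add: Mor_EO order_preserving_id dom_id ran_id)

lemma ran_eq_image: "ran f = (\<lambda>x. the (f x)) ` dom f"
  by (force simp: ran_def dom_def)

lemma card_ran_le_card_dom: "finite (dom f) \<Longrightarrow> card (ran f) \<le> card (dom f)"
  unfolding ran_eq_image by (rule card_image_le)

lemma finite_dom_Mor_EO: "f \<in> Mor (EO n) \<Longrightarrow> finite (dom f)"
  by (auto simp: Mor_EO intro: finite_subset)

text \<open>Applying \<open>f\<close> to the increasing enumeration of its domain gives a sorted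
  distinct list with the same elements, and there is only one such list.\<close>

lemma order_preserving_automorphism:
  assumes "order_preserving f" "finite (dom f)" "ran f = dom f"
  shows "f = Some |` dom f"
proof -
  let ?xs = "sorted_list_of_set (dom f)" and ?h = "\<lambda>x. the (f x)"
  have "inj_on ?h (dom f)"
    using assms ran_eq_image[of f] by (intro eq_card_imp_inj_on) auto
  then have "distinct (map ?h ?xs)"
    using assms(2) by (simp add: distinct_map)
  moreover have "sorted (map ?h ?xs)"
    using assms(1,2) unfolding sorted_map order_preserving_def
    by (intro sorted_wrt_mono_rel[OF _ sorted_sorted_list_of_set]) auto
  moreover have "set (map ?h ?xs) = set ?xs"
    using assms(2,3) ran_eq_image[of f] by simp
  ultimately have "map ?h ?xs = ?xs"
    by (intro sorted_distinct_set_unique) simp_all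
  then have "?h x = x" if "x \<in> dom f" for x
    using assms(2) that by (metis map_eq_conv map_ident set_sorted_list_of_set)
  then have "f x = (Some |` dom f) x" for x
    by (cases "f x") (force simp: restrict_map_def)+
  then show ?thesis ..
qed

text \<open>Equal finite cardinalities make \<open>f\<close> injective, and the inverse of an
  order-preserving injection between chains preserves the order.\<close>

lemma order_preserving_inverse:
  assumes "order_preserving f" "finite (dom f)" "card (ran f) = card (dom f)"
  obtains g where "order_preserving g" "dom g = ran f" "ran g = dom f"
    "g \<circ>\<^sub>m f = Some |` dom f" "f \<circ>\<^sub>m g = Some |` ran f"
proof -
  let ?h = "\<lambda>x. the (f x)"
  have inj: "inj_on ?h (dom f)"
    using assms ran_eq_image[of f] by (intro eq_card_imp_inj_on) auto
  define g where "g = (\<lambda>y. if y \<in> ran f then Some (inv_into (dom f) ?h y) else None)"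
  \<comment> \<open>The graph of \<open>g\<close> is the converse of the graph of \<open>f\<close>;
    the remaining claims are read off from this.\<close>
  have gf: "g y = Some x \<longleftrightarrow> f x = Some y" for x y
  proof
    assume "g y = Some x"
    then have "y \<in> ?h ` dom f" "x = inv_into (dom f) ?h y"
      by (auto simp: g_def ran_eq_image split: if_splits)
    then have "x \<in> dom f" "?h x = y"
      using f_inv_into_f[of y ?h "dom f"] by (simp_all add: inv_into_into)
    then show "f x = Some y" by auto
  next
    assume "f x = Some y"
    then show "g y = Some x"
      using inv_into_f_f[OF inj, of x] by (auto simp: g_def ranI)
  qed
  have "order_preserving g"
    unfolding order_preserving_def
  proof (intro ballI impI)
    fix y z assume "y \<in> dom g" "z \<in> dom g" "y \<le> z"
    then obtain u v where uv: "f u = Some y" "f v = Some z" "g y = Some u" "g z = Some v"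
      using gf by blast
    have "u \<le> v"
    proof (rule ccontr)
      assume "\<not> u \<le> v"
      then have "z \<le> y"
        using assms(1) uv unfolding order_preserving_def by (metis domI nle_le option.sel)
      \<comment> \<open>Now \<open>y = z\<close>, hence \<open>u = v\<close> as both are the value
        of \<open>g\<close> there.\<close>
      then show False
        using \<open>y \<le> z\<close> uv \<open>\<not> u \<le> v\<close> by simp
    qed
    then show "the (g y) \<le> the (g z)" using uv by simp
  qed
  moreover have "dom g = ran f"
    by (auto simp: g_def split: if_splits)
  moreover have "ran g = dom f"
    using gf by (auto simp: ran_def dom_def)
  moreover have "g \<circ>\<^sub>m f = Some |` dom f"
    using gf by (intro ext) (auto simp: map_comp_def restrict_map_def split: option.splits)
  moreover have "f \<circ>\<^sub>m g = Some |` ran f"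
    using gf by (intro ext) (auto simp: map_comp_def restrict_map_def \<open>dom g = ran f\<close>[symmetric] split: option.splits)
  ultimately show thesis by (rule that)
qed

section \<open>Left ideals spanned by morphisms, and a family of maximal ones\<close>

lemma ring_EO: "ring (category_algebra (EO n) :: ('k::field, _ \<Rightarrow>\<^sub>0 'k) module)"
  by (rule category.ring_category_algebra[OF category_EO]) simp

lemma left_ideal_span_on_EO:
  assumes "T \<subseteq> Mor (EO n)"
    and "\<And>g f. g \<in> Mor (EO n) \<Longrightarrow> f \<in> T \<Longrightarrow> ran f = dom g \<Longrightarrow> g \<circ>\<^sub>m f \<in> T"
  shows "left_ideal (span_on T) (category_algebra (EO n) :: ('k::field, _ \<Rightarrow>\<^sub>0 'k) module)"
  unfolding left_ideal_def
proof (intro conjI ballI)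
  let ?R = "category_algebra (EO n) :: ('k, _ \<Rightarrow>\<^sub>0 'k) module"
  show "additive_subgroup (span_on T) ?R"
    using assms(1) by (intro additive_subgroup_span_on ring_EO) (auto simp: category_algebra_simps)
  fix a x :: "(nat \<rightharpoonup> nat) \<Rightarrow>\<^sub>0 'k" assume "a \<in> carrier ?R" "x \<in> span_on T"
  then show "a \<otimes>\<^bsub>?R\<^esub> x \<in> span_on T"
    using assms(2)
    by (fastforce simp: category_algebra_simps composable_EO dest!: subsetD[OF keys_conv])
qed

text \<open>
  Modulo this left ideal only the isomorphisms with domain \<open>A\<close> survive; the quotient is the
  simple module attached to the isomorphism class of the object \<open>A\<close>.
\<close>

definition column_ideal :: "nat \<Rightarrow> nat set \<Rightarrow> ((nat \<rightharpoonup> nat) \<Rightarrow>\<^sub>0 'k::field) set" where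
  "column_ideal n A = span_on {f \<in> Mor (EO n). dom f = A \<longrightarrow> card (ran f) < card A}"

text \<open>Postcomposition keeps the domain and cannot enlarge the range.\<close>

lemma left_ideal_column_ideal:
  "left_ideal (column_ideal n A) (category_algebra (EO n) :: ('k::field, _ \<Rightarrow>\<^sub>0 'k) module)"
  unfolding column_ideal_def
proof (rule left_ideal_span_on_EO)
  fix g f assume g: "g \<in> Mor (EO n)" and "ran f = dom g"
    and f: "f \<in> {f \<in> Mor (EO n). dom f = A \<longrightarrow> card (ran f) < card A}"
  then show "g \<circ>\<^sub>m f \<in> {f \<in> Mor (EO n). dom f = A \<longrightarrow> card (ran f) < card A}"
    using comp_in_Mor_EO[of g n f] card_ran_le_card_dom[OF finite_dom_Mor_EO[OF g]]
    by (auto simp: dom_comp_onto ran_comp_onto)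
qed auto

text \<open>A left ideal \<open>J\<close> strictly above contains an element with nonzero
  coefficient at some isomorphism \<open>q\<close> out of \<open>A\<close>. Multiplying it on the
  left by a multiple of the inverse of \<open>q\<close> gives the identity of \<open>A\<close>
  modulo the column ideal. So this identity lies in \<open>J\<close>, and every \<open>b\<close> is
  congruent to its product with it.\<close>

lemma maximal_column_ideal:
  assumes A: "A \<subseteq> {1..n}"
  shows "maximal_left_ideal (column_ideal n A) (category_algebra (EO n) :: ('k::field, _ \<Rightarrow>\<^sub>0 'k) module)"
  unfolding maximal_left_ideal_def
proof (intro conjI allI impI)
  let ?R = "category_algebra (EO n) :: ('k, _ \<Rightarrow>\<^sub>0 'k) module"
  let ?M = "column_ideal n A :: ((nat \<rightharpoonup> nat) \<Rightarrow>\<^sub>0 'k) set"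
  let ?i = "Poly_Mapping.single (Some |` A) (1::'k)"
  have finA: "finite A" using A finite_subset by blast
  have i: "?i \<in> carrier ?R"
    using A by (simp add: category_algebra_simps Ident_in_Mor_EO)
  show "left_ideal ?M ?R" by (rule left_ideal_column_ideal)
  have "?i \<notin> ?M" by (simp add: column_ideal_def dom_id ran_id)
  then show "?M \<noteq> carrier ?R" using i by metis
  fix J assume J: "left_ideal J ?R" and MJ: "?M \<subseteq> J"
  interpret J: additive_subgroup J ?R using J by (simp add: left_ideal_def)
  have J_add: "a + b \<in> J" if "a \<in> J" "b \<in> J" for a b
    using J.a_closed[OF that] by (simp add: category_algebra_simps)
  have J_mult: "conv (composable (EO n)) (\<circ>\<^sub>m) a b \<in> J" if "Poly_Mapping.keys a \<subseteq> Mor (EO n)" "b \<in> J" for a b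
    using J that by (simp add: left_ideal_def category_algebra_simps)
  have J_sub: "Poly_Mapping.keys a \<subseteq> Mor (EO n)" if "a \<in> J" for a
    using J.a_subset that by (auto simp: category_algebra_simps)
  \<comment> \<open>Since ranges are never larger than domains, membership amounts to vanishing
    coefficients at the isomorphisms with domain \<open>A\<close>.\<close>
  have M_iff: "a \<in> ?M \<longleftrightarrow> Poly_Mapping.keys a \<subseteq> Mor (EO n) \<and>
      (\<forall>f\<in>Mor (EO n). dom f = A \<longrightarrow> card (ran f) = card A \<longrightarrow> Poly_Mapping.lookup a f = 0)" for a
  proof -
    have "card (ran f) < card A \<longleftrightarrow> card (ran f) \<noteq> card A" if "dom f = A" for f :: "nat \<rightharpoonup> nat"
      using card_ran_le_card_dom[of f] that finA by auto
    then show ?thesis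
      by (auto simp: column_ideal_def in_keys_iff subset_iff)
  qed
  show "J = ?M \<or> J = carrier ?R"
  proof (rule disjCI)
    assume "J \<noteq> carrier ?R"
    show "J = ?M"
    proof (rule ccontr)
      assume "J \<noteq> ?M"
      then obtain a where a: "a \<in> J" "a \<notin> ?M" using MJ by blast
      then obtain q where q: "q \<in> Mor (EO n)" "dom q = A" "card (ran q) = card A"
        "Poly_Mapping.lookup a q \<noteq> 0"
        using M_iff J_sub by blast
      obtain r where r: "order_preserving r" "dom r = ran q" "ran r = A"
        "r \<circ>\<^sub>m q = Some |` A" "q \<circ>\<^sub>m r = Some |` ran q"
        using order_preserving_inverse[of q] q finA by (auto simp: Mor_EO)
      have rM: "r \<in> Mor (EO n)" using r A q by (simp add: Mor_EO)
      let ?c = "Poly_Mapping.lookup a q"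
      \<comment> \<open>Composition with \<open>r\<close>, the inverse of \<open>q\<close>, moves
        the coefficient of \<open>q\<close> to the identity of \<open>A\<close>, and dividing by
        \<open>?c\<close> makes it 1.\<close>
      define e where "e = conv (composable (EO n)) (\<circ>\<^sub>m) (Poly_Mapping.single r (1 / ?c)) a"
      have e: "e \<in> J" unfolding e_def using a rM by (intro J_mult) auto
      have "?i - e \<in> ?M"
        unfolding M_iff
      proof (intro conjI ballI impI)
        show "Poly_Mapping.keys (?i - e) \<subseteq> Mor (EO n)"
          using i J_sub[OF e] by (intro keys_diff_subset) (simp_all add: category_algebra_simps)
        fix f assume f: "f \<in> Mor (EO n)" "dom f = A" "card (ran f) = card A"
        have e_f: "Poly_Mapping.lookup e f = (\<Sum>y\<in>Poly_Mapping.keys a.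
            if composable (EO n) r y \<and> r \<circ>\<^sub>m y = f then (1 / ?c) * Poly_Mapping.lookup a y else 0)"
          unfolding e_def by (rule lookup_conv_single_left)
        \<comment> \<open>A composite \<open>f\<close> of this kind has domain and range
          \<open>A\<close>, so it is the identity by rigidity of finite chains; composing with
          \<open>q\<close> then recovers \<open>y = q\<close>.\<close>
        have iff: "composable (EO n) r y \<and> r \<circ>\<^sub>m y = f \<longleftrightarrow> f = Some |` A \<and> y = q"
          if "y \<in> Poly_Mapping.keys a" for y
        proof
          assume *: "composable (EO n) r y \<and> r \<circ>\<^sub>m y = f"
          then have "ran f = A"
            using r ran_comp_onto[of y r] by (simp add: composable_EO)
          then have fA: "f = Some |` A"
            using order_preserving_automorphism[of f] f finA by (simp add: Mor_EO)
          have "q = q \<circ>\<^sub>m f"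
            using fA q(2) by (simp add: map_comp_id_right)
          also have "\<dots> = (Some |` ran q) \<circ>\<^sub>m y"
            using * r(5) by (metis map_comp_assoc)
          also have "\<dots> = y"
            using * r(2) by (simp add: composable_EO map_comp_id_left)
          finally show "f = Some |` A \<and> y = q" using fA by simp
        qed (use q r rM in \<open>simp add: composable_EO\<close>)
        show "Poly_Mapping.lookup (?i - e) f = 0"
        proof (cases "f = Some |` A")
          case True
          then have "Poly_Mapping.lookup e f =
              (\<Sum>y\<in>Poly_Mapping.keys a. if y = q then (1 / ?c) * Poly_Mapping.lookup a y else 0)"
            unfolding e_f using iff by (intro sum.cong) auto
          also have "\<dots> = 1"
            using q(4) by (simp add: in_keys_iff)
          finally show ?thesis using True by (simp add: lookup_minus)
        next
          case False
          then have "Poly_Mapping.lookup e f = 0"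
            unfolding e_f using iff by (intro sum.neutral) auto
          then show ?thesis using False by (simp add: lookup_minus lookup_single_not_eq)
        qed
      qed
      then have "(?i - e) + e \<in> J" using MJ e by (intro J_add) auto
      then have iJ: "?i \<in> J" by simp
      have "b \<in> J" if "b \<in> carrier ?R" for b
      proof -
        have b: "Poly_Mapping.keys b \<subseteq> Mor (EO n)" using that by (simp add: category_algebra_simps)
        \<comment> \<open>Right multiplication by the identity of \<open>A\<close> keeps exactly the
          terms of \<open>b\<close> with domain \<open>A\<close>, so \<open>b - d\<close> has no
          isomorphism with domain \<open>A\<close> in its support.\<close>
        define d where "d = conv (composable (EO n)) (\<circ>\<^sub>m) b ?i"
        have d: "d \<in> J" unfolding d_def using b iJ by (rule J_mult)
        have "b - d \<in> ?M"
          unfolding M_iff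
        proof (intro conjI ballI impI)
          show "Poly_Mapping.keys (b - d) \<subseteq> Mor (EO n)"
            using b J_sub[OF d] by (intro keys_diff_subset)
          fix f assume f: "f \<in> Mor (EO n)" "dom f = A" "card (ran f) = card A"
          have "Poly_Mapping.lookup d f = (\<Sum>x\<in>Poly_Mapping.keys b.
              if composable (EO n) x (Some |` A) \<and> x \<circ>\<^sub>m (Some |` A) = f then Poly_Mapping.lookup b x else 0)"
            by (simp add: d_def lookup_conv_single_right cong: if_cong)
          also have "\<dots> = (\<Sum>x\<in>Poly_Mapping.keys b. if x = f then Poly_Mapping.lookup b x else 0)"
          proof (rule sum.cong)
            fix x assume "x \<in> Poly_Mapping.keys b"
            then have "x \<in> Mor (EO n)" using b by blast
            then have "composable (EO n) x (Some |` A) \<longleftrightarrow> dom x = A"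
              using Ident_in_Mor_EO[OF A] by (auto simp: composable_EO ran_id)
            then have "composable (EO n) x (Some |` A) \<and> x \<circ>\<^sub>m (Some |` A) = f \<longleftrightarrow> x = f"
              using f(2) map_comp_id_right[of x A] by (metis order_refl)
            then show "(if composable (EO n) x (Some |` A) \<and> x \<circ>\<^sub>m (Some |` A) = f
                then Poly_Mapping.lookup b x else 0) = (if x = f then Poly_Mapping.lookup b x else 0)"
              by simp
          qed simp
          also have "\<dots> = Poly_Mapping.lookup b f"
            by (simp add: in_keys_iff)
          finally show "Poly_Mapping.lookup (b - d) f = 0" by (simp add: lookup_minus)
        qed
        then have "(b - d) + d \<in> J" using MJ d by (intro J_add) auto
        then show ?thesis by simp
      qed
      then show False using \<open>J \<noteq> carrier ?R\<close> J.a_subset by blast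
    qed
  qed
qed

text \<open>By \<open>order_preserving_inverse\<close> a morphism between sets of equal size is
  invertible, so the strict inequality selects the non-isomorphisms.\<close>

definition noniso_ideal :: "nat \<Rightarrow> ((nat \<rightharpoonup> nat) \<Rightarrow>\<^sub>0 'k::field) set" where
  "noniso_ideal n = span_on {f \<in> Mor (EO n). card (ran f) < card (dom f)}"

lemma left_ideal_noniso_ideal:
  "left_ideal (noniso_ideal n) (category_algebra (EO n) :: ('k::field, _ \<Rightarrow>\<^sub>0 'k) module)"
  unfolding noniso_ideal_def
proof (rule left_ideal_span_on_EO)
  fix g f assume g: "g \<in> Mor (EO n)" and "ran f = dom g"
    and f: "f \<in> {f \<in> Mor (EO n). card (ran f) < card (dom f)}"
  then show "g \<circ>\<^sub>m f \<in> {f \<in> Mor (EO n). card (ran f) < card (dom f)}"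
    using comp_in_Mor_EO[of g n f] card_ran_le_card_dom[OF finite_dom_Mor_EO[OF g]]
    by (auto simp: dom_comp_onto ran_comp_onto)
qed auto

text \<open>Losses of cardinality add up under composition: the left factor loses at least
  \<open>m\<close> elements and the right factor at least one.\<close>

lemma ideal_power_noniso_ideal_subset:
  "ideal_power (category_algebra (EO n)) (noniso_ideal n) m \<subseteq>
     (span_on {f \<in> Mor (EO n). card (ran f) + m \<le> card (dom f)} :: ((nat \<rightharpoonup> nat) \<Rightarrow>\<^sub>0 'k::field) set)"
proof (induction m)
  case 0
  then show ?case
    using card_ran_le_card_dom finite_dom_Mor_EO by (auto simp: category_algebra_simps)
next
  case (Suc m)
  have "a \<in> span_on {f \<in> Mor (EO n). card (ran f) + Suc m \<le> card (dom f)}"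
    if "a \<in> ideal_power (category_algebra (EO n)) (noniso_ideal n) (Suc m)"
    for a :: "(nat \<rightharpoonup> nat) \<Rightarrow>\<^sub>0 'k"
    using that unfolding ideal_power.simps
  proof induction
    case (prod a b)
    have "Poly_Mapping.keys a \<subseteq> {f \<in> Mor (EO n). card (ran f) + m \<le> card (dom f)}"
      using prod(1) Suc by blast
    moreover have "Poly_Mapping.keys b \<subseteq> {f \<in> Mor (EO n). card (ran f) < card (dom f)}"
      using prod(2) by (simp add: noniso_ideal_def)
    moreover have "g \<circ>\<^sub>m f \<in> {f \<in> Mor (EO n). card (ran f) + Suc m \<le> card (dom f)}"
      if "g \<in> {f \<in> Mor (EO n). card (ran f) + m \<le> card (dom f)}"
        "f \<in> {f \<in> Mor (EO n). card (ran f) < card (dom f)}" "composable (EO n) g f" for f g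
      using that comp_in_Mor_EO[of g n f] by (auto simp: composable_EO dom_comp_onto ran_comp_onto)
    ultimately have "Poly_Mapping.keys (conv (composable (EO n)) (\<circ>\<^sub>m) a b) \<subseteq>
        {f \<in> Mor (EO n). card (ran f) + Suc m \<le> card (dom f)}"
      using keys_conv[of "composable (EO n)" "(\<circ>\<^sub>m)" a b] by blast
    then show ?case by (simp add: category_algebra_simps)
  next
    case (sum a b)
    then show ?case using keys_add[of a b] by (auto simp: category_algebra_simps)
  qed
  then show ?case by blast
qed

text \<open>A loss of \<open>n\<close> elements would require a map from all of
  \<open>{1..n}\<close> onto the empty set. For \<open>n = 0\<close> the empty map would survive, so
  here \<open>n \<ge> 1\<close> enters.\<close>

lemma ideal_power_noniso_ideal_eq_zero:
  assumes "n \<ge> 1"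
  shows "ideal_power (category_algebra (EO n)) (noniso_ideal n) n =
    {\<zero>\<^bsub>category_algebra (EO n) :: ('k::field, _ \<Rightarrow>\<^sub>0 'k) module\<^esub>}"
proof -
  let ?R = "category_algebra (EO n) :: ('k, _ \<Rightarrow>\<^sub>0 'k) module"
  have "f \<notin> {f \<in> Mor (EO n). card (ran f) + n \<le> card (dom f)}" for f
  proof
    assume f: "f \<in> {f \<in> Mor (EO n). card (ran f) + n \<le> card (dom f)}"
    then have "card (dom f) \<le> n"
      using card_mono[of "{1..n}" "dom f"] by (simp add: Mor_EO)
    then have "card (ran f) = 0" "card (dom f) = n" using f by auto
    moreover have "finite (ran f)" using f by (auto simp: Mor_EO intro: finite_subset)
    ultimately show False
      using assms by (auto simp: ran_eq_image)
  qed
  then have "(span_on {f \<in> Mor (EO n). card (ran f) + n \<le> card (dom f)}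
      :: ((nat \<rightharpoonup> nat) \<Rightarrow>\<^sub>0 'k) set) \<subseteq> {0}"
    by (auto simp: subset_iff simp flip: keys_eq_empty)
  moreover have "\<zero>\<^bsub>?R\<^esub> \<in> ideal_power ?R (noniso_ideal n) n"
    by (intro ring.zero_in_ideal_power[OF ring_EO]) (simp add: category_algebra_simps noniso_ideal_def)
  ultimately show ?thesis
    using ideal_power_noniso_ideal_subset[of n n, where 'k = 'k] by (auto simp: category_algebra_simps)
qed

text \<open>Nilpotency gives one inclusion. For the other, each \<open>f\<close> in the support of a
  radical element is tested against the maximal column ideal of its own domain.\<close>

lemma jacobson_radical_EO:
  assumes "n \<ge> 1"
  shows "jacobson_radical (category_algebra (EO n) :: ('k::field, _ \<Rightarrow>\<^sub>0 'k) module) = noniso_ideal n"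
proof
  let ?R = "category_algebra (EO n) :: ('k, _ \<Rightarrow>\<^sub>0 'k) module"
  have "noniso_ideal n \<subseteq> carrier ?R" by (auto simp: noniso_ideal_def category_algebra_simps)
  moreover have "noniso_ideal n \<subseteq> M" if "maximal_left_ideal M ?R" for M
    using ring.nilpotent_left_ideal_subset_maximal[OF ring_EO left_ideal_noniso_ideal
        ideal_power_noniso_ideal_eq_zero[OF assms] that] .
  ultimately show "noniso_ideal n \<subseteq> jacobson_radical ?R"
    by (auto simp: jacobson_radical_def)
  show "jacobson_radical ?R \<subseteq> noniso_ideal n"
  proof
    fix a assume a: "a \<in> jacobson_radical ?R"
    have "f \<in> Mor (EO n) \<and> card (ran f) < card (dom f)" if f: "f \<in> Poly_Mapping.keys a" for f
    proof -
      have "f \<in> Mor (EO n)"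
        using a f by (auto simp: jacobson_radical_def category_algebra_simps)
      then have "maximal_left_ideal (column_ideal n (dom f)) ?R"
        by (intro maximal_column_ideal) (simp add: Mor_EO)
      then have "a \<in> column_ideal n (dom f)"
        using a by (auto simp: jacobson_radical_def)
      then show ?thesis using f by (auto simp: column_ideal_def)
    qed
    then show "a \<in> noniso_ideal n" by (auto simp: noniso_ideal_def)
  qed
qed

section \<open>A nonzero product of \<open>n - 1\<close> non-isomorphisms\<close>

definition const_on :: "nat \<Rightarrow> nat \<rightharpoonup> nat" where
  "const_on m = (\<lambda>x. if x \<in> {1..m} then Some 1 else None)"

text \<open>For positive \<open>m\<close> this is the surjection onto \<open>{1..m}\<close>
  identifying the two top points, a loss of exactly one element; \<open>const_on (Suc m)\<close> is
  the composite of \<open>collapse 1\<close>, ..., \<open>collapse m\<close>.\<close>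

definition collapse :: "nat \<Rightarrow> nat \<rightharpoonup> nat" where
  "collapse m = (\<lambda>x. if x \<in> {1..Suc m} then Some (min x m) else None)"

text \<open>Each \<open>collapse\<close> contributes one factor from the ideal. The start
  \<open>const_on 1\<close> is the identity of \<open>{1}\<close>, and \<open>m < n\<close> keeps
  the domain \<open>{1..Suc m}\<close> inside \<open>{1..n}\<close>.\<close>

lemma const_on_in_ideal_power:
  assumes "m < n"
  shows "Poly_Mapping.single (const_on (Suc m)) 1 \<in>
    ideal_power (category_algebra (EO n) :: ('k::field, _ \<Rightarrow>\<^sub>0 'k) module) (noniso_ideal n) m"
  using assms
proof (induction m)
  case 0
  then show ?case
    by (auto simp: category_algebra_simps Mor_EO const_on_def dom_def ran_def order_preserving_def)
next
  case (Suc m)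
  let ?R = "category_algebra (EO n) :: ('k, _ \<Rightarrow>\<^sub>0 'k) module"
  have dom_const: "dom (const_on k) = {1..k}" for k
    by (auto simp: const_on_def split: if_splits)
  have dom_collapse: "dom (collapse k) = {1..Suc k}" for k
    by (auto simp: collapse_def split: if_splits)
  have ran_collapse: "ran (collapse (Suc m)) = {1..Suc m}"
  proof -
    have "(\<lambda>x. min x (Suc m)) ` {1..Suc (Suc m)} = {1..Suc m}"
      by (force simp: image_iff)
    then show ?thesis unfolding ran_eq_image dom_collapse by (simp add: collapse_def)
  qed
  have collapse: "collapse (Suc m) \<in> Mor (EO n)"
    using Suc.prems by (auto simp: Mor_EO dom_collapse ran_collapse order_preserving_def)
      (auto simp: collapse_def)
  have const: "const_on (Suc m) \<in> Mor (EO n)"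
    using Suc.prems
    by (auto simp: Mor_EO dom_const order_preserving_def)
      (auto simp: const_on_def ran_def split: if_splits)
  \<comment> \<open>The new factor acts first and stands on the right, as in the recursion of
    \<open>ideal_power\<close>.\<close>
  have "const_on (Suc m) \<circ>\<^sub>m collapse (Suc m) = const_on (Suc (Suc m))"
    by (rule ext) (auto simp: const_on_def collapse_def map_comp_def)
  then have "Poly_Mapping.single (const_on (Suc m)) 1 \<otimes>\<^bsub>?R\<^esub> Poly_Mapping.single (collapse (Suc m)) 1
      = Poly_Mapping.single (const_on (Suc (Suc m))) 1"
    using const collapse by (simp add: category_algebra_simps composable_EO dom_const ran_collapse)
  moreover have "Poly_Mapping.single (collapse (Suc m)) 1 \<in> noniso_ideal n"
    using collapse by (simp add: noniso_ideal_def ran_collapse dom_collapse)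
  ultimately show ?case
    using ideal_prod.prod[of _ "ideal_power ?R (noniso_ideal n) m" _ "noniso_ideal n" ?R] Suc
    by (metis Suc_lessD ideal_power.simps(2))
qed

lemma loewy_length_EO:
  assumes "n \<ge> 1"
  shows "loewy_length (category_algebra (EO n) :: ('k::field, _ \<Rightarrow>\<^sub>0 'k) module) = n"
  unfolding loewy_length_def jacobson_radical_EO[OF assms]
proof (rule Least_equality)
  show "ideal_power (category_algebra (EO n)) (noniso_ideal n) n =
      {\<zero>\<^bsub>category_algebra (EO n) :: ('k, _ \<Rightarrow>\<^sub>0 'k) module\<^esub>}"
    by (rule ideal_power_noniso_ideal_eq_zero[OF assms])
  fix m assume m: "ideal_power (category_algebra (EO n)) (noniso_ideal n) m =
      {\<zero>\<^bsub>category_algebra (EO n) :: ('k, _ \<Rightarrow>\<^sub>0 'k) module\<^esub>}"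
  show "n \<le> m"
  proof (rule ccontr)
    assume "\<not> n \<le> m"
    then have "Poly_Mapping.single (const_on (Suc m)) (1::'k) = 0"
      using const_on_in_ideal_power[of m n, where 'k = 'k] m by (simp add: category_algebra_simps)
    then show False by (metis lookup_single_eq lookup_zero zero_neq_one)
  qed
qed

section \<open>The isomorphism between the two algebras\<close>

text \<open>The zeta transform for inclusion of graphs. Indexing by subsets of the domain counts
  every restriction once; on an infinite domain the inner sum would default to 0.\<close>

definition restriction_sum ::
    "(('a \<rightharpoonup> 'b) \<Rightarrow>\<^sub>0 'k) \<Rightarrow> (('a \<rightharpoonup> 'b) \<Rightarrow>\<^sub>0 'k::field)" where
  "restriction_sum a = (\<Sum>f\<in>Poly_Mapping.keys a. \<Sum>A\<in>Pow (dom f).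
     Poly_Mapping.single (f |` A) (Poly_Mapping.lookup a f))"

lemma restriction_sum_add: "restriction_sum (a + b) = restriction_sum a + restriction_sum b"
  unfolding restriction_sum_def
  by (rule setsum_keys_plus_distrib) (auto simp: single_add sum.distrib)

lemma restriction_sum_zero [simp]: "restriction_sum 0 = 0"
  by (simp add: restriction_sum_def)

lemma restriction_sum_diff: "restriction_sum (a - b) = restriction_sum a - restriction_sum b"
  using restriction_sum_add[of "a - b" b] by simp

lemma restriction_sum_single [simp]:
  "restriction_sum (Poly_Mapping.single f c) = (\<Sum>A\<in>Pow (dom f). Poly_Mapping.single (f |` A) c)"
  by (simp add: restriction_sum_def)

text \<open>Identifies the restrictions of \<open>g\<close> with the maps below \<open>g\<close>,
  each coming from a unique subset of the domain.\<close>

lemma restriction_eq_iff: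
  assumes "A \<subseteq> dom g"
  shows "g |` A = f \<longleftrightarrow> A = dom f \<and> f \<subseteq>\<^sub>m g"
proof
  assume "g |` A = f"
  then have f: "f = g |` A" by simp
  show "A = dom f \<and> f \<subseteq>\<^sub>m g"
    unfolding f using assms by (auto simp: map_le_def)
next
  assume "A = dom f \<and> f \<subseteq>\<^sub>m g"
  then show "g |` A = f"
    by (auto simp: map_le_def restrict_map_def fun_eq_iff)
qed

lemma lookup_restriction_sum:
  assumes "\<And>f. f \<in> Poly_Mapping.keys a \<Longrightarrow> finite (dom f)"
  shows "Poly_Mapping.lookup (restriction_sum a) f =
    (\<Sum>g\<in>Poly_Mapping.keys a. if f \<subseteq>\<^sub>m g then Poly_Mapping.lookup a g else 0)"
  unfolding restriction_sum_def lookup_sum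
proof (intro sum.cong refl)
  fix g assume g: "g \<in> Poly_Mapping.keys a"
  have "(\<Sum>A\<in>Pow (dom g). Poly_Mapping.lookup (Poly_Mapping.single (g |` A) (Poly_Mapping.lookup a g)) f) =
      (\<Sum>A\<in>Pow (dom g). if A = dom f then (if f \<subseteq>\<^sub>m g then Poly_Mapping.lookup a g else 0) else 0)"
    by (intro sum.cong refl) (auto simp: lookup_single when_def restriction_eq_iff)
  also have "\<dots> = (if f \<subseteq>\<^sub>m g then Poly_Mapping.lookup a g else 0)"
    using assms[OF g] by (auto dest: map_le_implies_dom_le)
  finally show "(\<Sum>A\<in>Pow (dom g). Poly_Mapping.lookup (Poly_Mapping.single (g |` A) (Poly_Mapping.lookup a g)) f) =
      (if f \<subseteq>\<^sub>m g then Poly_Mapping.lookup a g else 0)" .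
qed

text \<open>At an \<open>f\<close> with largest domain in the support of \<open>a\<close>, no other
  map of the support extends \<open>f\<close>, so the transform has the same nonzero coefficient
  there as \<open>a\<close>.\<close>

lemma restriction_sum_eq_zero:
  assumes fin: "\<And>f. f \<in> Poly_Mapping.keys a \<Longrightarrow> finite (dom f)" and zero: "restriction_sum a = 0"
  shows "a = 0"
proof (rule ccontr)
  assume "a \<noteq> 0"
  then have ne: "Poly_Mapping.keys a \<noteq> {}" by simp
  let ?c = "\<lambda>f. card (dom f)"
  have "Max (?c ` Poly_Mapping.keys a) \<in> ?c ` Poly_Mapping.keys a"
    using ne by (intro Max_in) auto
  then obtain f where f: "f \<in> Poly_Mapping.keys a" "?c f = Max (?c ` Poly_Mapping.keys a)"
    by force
  have "f \<subseteq>\<^sub>m g \<longleftrightarrow> g = f" if g: "g \<in> Poly_Mapping.keys a" for g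
  proof
    assume le: "f \<subseteq>\<^sub>m g"
    have "?c g \<le> ?c f" unfolding f(2) using g by (intro Max_ge) auto
    then have "dom g = dom f"
      using card_seteq[OF fin[OF g] map_le_implies_dom_le[OF le]] by simp
    with le show "g = f"
      using restriction_eq_iff[of "dom g" g] by (metis map_le_refl order_refl)
  qed simp
  then have "Poly_Mapping.lookup (restriction_sum a) f =
      (\<Sum>g\<in>Poly_Mapping.keys a. if g = f then Poly_Mapping.lookup a g else 0)"
    by (subst lookup_restriction_sum[OF fin]) (auto intro!: sum.cong)
  also have "\<dots> = Poly_Mapping.lookup a f" using f(1) by simp
  finally show False using zero f(1) by (simp add: in_keys_iff)
qed

section \<open>Supports and surjectivity of the transform\<close>

lemma carrier_PO: "carrier (PO n) = Mor (EO n)"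
  by (simp add: PO_def Mor_EO)

lemma restrict_in_Mor_EO:
  assumes "f \<in> Mor (EO n)"
  shows "f |` A \<in> Mor (EO n)"
proof -
  have "ran (f |` A) \<subseteq> ran f" by (auto simp: ran_def restrict_map_def split: if_splits)
  then show ?thesis
    using assms by (auto simp: Mor_EO order_preserving_def)
qed

lemma keys_restriction_sum:
  assumes "Poly_Mapping.keys a \<subseteq> Mor (EO n)"
  shows "Poly_Mapping.keys (restriction_sum a) \<subseteq> Mor (EO n)"
proof
  fix h assume "h \<in> Poly_Mapping.keys (restriction_sum a)"
  then obtain f where f: "f \<in> Poly_Mapping.keys a" "h \<in> Poly_Mapping.keys (\<Sum>A\<in>Pow (dom f).
     Poly_Mapping.single (f |` A) (Poly_Mapping.lookup a f))"
    unfolding restriction_sum_def using keys_sum by fastforce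
  then obtain A where "h \<in> Poly_Mapping.keys (Poly_Mapping.single (f |` A) (Poly_Mapping.lookup a f))"
    using keys_sum by fastforce
  then show "h \<in> Mor (EO n)"
    using assms f(1) restrict_in_Mor_EO by (auto split: if_splits)
qed

text \<open>The transform of a monomial is the monomial plus its proper restrictions. These have
  smaller domains and lie in the range by induction, so they can be subtracted.\<close>

lemma single_in_range_restriction_sum:
  assumes "f \<in> Mor (EO n)"
  shows "Poly_Mapping.single f c \<in> restriction_sum ` span_on (Mor (EO n))"
  using assms
proof (induction "card (dom f)" arbitrary: f rule: less_induct)
  case less
  let ?I = "restriction_sum ` span_on (Mor (EO n)) :: ((nat \<rightharpoonup> nat) \<Rightarrow>\<^sub>0 'a) set"
  have fin: "finite (dom f)" using finite_dom_Mor_EO[OF less.prems] .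
  have I_diff: "x - y \<in> ?I" if xy: "x \<in> ?I" "y \<in> ?I" for x y
  proof -
    obtain a b where ab: "a \<in> span_on (Mor (EO n))" "x = restriction_sum a"
      "b \<in> span_on (Mor (EO n))" "y = restriction_sum b" using xy by blast
    have "Poly_Mapping.keys (a - b) \<subseteq> Mor (EO n)"
      using ab keys_diff[of a b] by blast
    then show ?thesis
      unfolding ab(2,4) restriction_sum_diff[symmetric] by blast
  qed
  have zero: "0 \<in> ?I" by (intro image_eqI[of _ _ 0]) auto
  have I_add: "x + y \<in> ?I" if "x \<in> ?I" "y \<in> ?I" for x y
    using I_diff[OF that(1) I_diff[OF zero that(2)]] by simp
  have I_sum: "sum h X \<in> ?I" if "\<And>A. A \<in> X \<Longrightarrow> h A \<in> ?I" for h and X :: "nat set set"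
    using that by (induction X rule: infinite_finite_induct) (auto intro: zero I_add)
  have "restriction_sum (Poly_Mapping.single f c) \<in> ?I"
    using less.prems by (intro imageI) simp
  moreover have "(\<Sum>A\<in>Pow (dom f) - {dom f}. Poly_Mapping.single (f |` A) c) \<in> ?I"
  proof (rule I_sum)
    fix A assume "A \<in> Pow (dom f) - {dom f}"
    then have A: "A \<subset> dom f" by blast
    then have "dom (f |` A) = A" by auto
    then have "card (dom (f |` A)) < card (dom f)"
      using A fin by (simp add: psubset_card_mono)
    then show "Poly_Mapping.single (f |` A) c \<in> ?I"
      using less.hyps restrict_in_Mor_EO[OF less.prems] by blast
  qed
  ultimately have "restriction_sum (Poly_Mapping.single f c) -
      (\<Sum>A\<in>Pow (dom f) - {dom f}. Poly_Mapping.single (f |` A) c) \<in> ?I"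
    by (rule I_diff)
  moreover have "f |` dom f = f" by (simp add: restriction_eq_iff)
  ultimately show ?case
    using fin by (simp add: sum_diff1)
qed

lemma restriction_sum_comp:
  assumes g: "g \<in> Mor (EO n)" and f: "f \<in> Mor (EO n)"
  shows "restriction_sum (Poly_Mapping.single (g \<circ>\<^sub>m f) (c * d)) =
    conv (composable (EO n)) (\<circ>\<^sub>m) (restriction_sum (Poly_Mapping.single g c))
      (restriction_sum (Poly_Mapping.single f d))"
proof -
  have restrict_comp: "g |` B \<circ>\<^sub>m f |` A = (g \<circ>\<^sub>m f) |` A" if "B = ran (f |` A)" for A B
    using that by (auto simp: fun_eq_iff map_comp_def restrict_map_def ran_def split: option.splits)
  have "conv (composable (EO n)) (\<circ>\<^sub>m) (restriction_sum (Poly_Mapping.single g c))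
      (restriction_sum (Poly_Mapping.single f d)) =
    (\<Sum>A\<in>Pow (dom f). \<Sum>B\<in>Pow (dom g). if composable (EO n) (g |` B) (f |` A)
      then Poly_Mapping.single (g |` B \<circ>\<^sub>m f |` A) (c * d) else 0)"
    by (simp add: conv_sum_left conv_sum_right sum.swap[of _ "Pow (dom g)"])
  \<comment> \<open>Composability in \<open>EO n\<close> demands equality of range and domain, which
    fixes \<open>B\<close>.\<close>
  also have "\<dots> = (\<Sum>A\<in>Pow (dom f). \<Sum>B\<in>Pow (dom g).
      if B = ran (f |` A) then Poly_Mapping.single ((g \<circ>\<^sub>m f) |` A) (c * d) else 0)"
    using restrict_in_Mor_EO[OF f] restrict_in_Mor_EO[OF g] restrict_comp
    by (intro sum.cong refl) (auto simp: composable_EO Int_absorb1)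
  also have "\<dots> = (\<Sum>A\<in>Pow (dom f). if A \<in> Pow (dom (g \<circ>\<^sub>m f))
      then Poly_Mapping.single ((g \<circ>\<^sub>m f) |` A) (c * d) else 0)"
  proof (intro sum.cong refl)
    fix A assume "A \<in> Pow (dom f)"
    then have A: "A \<subseteq> dom f" by simp
    then have "ran (f |` A) = (\<lambda>x. the (f x)) ` A"
      by (simp add: ran_eq_image Int_absorb1)
    moreover have "x \<in> dom (g \<circ>\<^sub>m f) \<longleftrightarrow> the (f x) \<in> dom g" if "x \<in> A" for x
    proof -
      obtain y where "f x = Some y" using A \<open>x \<in> A\<close> by blast
      then show ?thesis by (simp add: dom_def)
    qed
    ultimately have "ran (f |` A) \<subseteq> dom g \<longleftrightarrow> A \<subseteq> dom (g \<circ>\<^sub>m f)"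
      by (simp add: image_subset_iff subset_eq)
    then show "(\<Sum>B\<in>Pow (dom g). if B = ran (f |` A) then Poly_Mapping.single ((g \<circ>\<^sub>m f) |` A) (c * d) else 0) =
        (if A \<in> Pow (dom (g \<circ>\<^sub>m f)) then Poly_Mapping.single ((g \<circ>\<^sub>m f) |` A) (c * d) else 0)"
      using finite_dom_Mor_EO[OF g] by simp
  qed
  also have "\<dots> = (\<Sum>A\<in>Pow (dom (g \<circ>\<^sub>m f)). Poly_Mapping.single ((g \<circ>\<^sub>m f) |` A) (c * d))"
  proof -
    have "dom (g \<circ>\<^sub>m f) \<subseteq> dom f" by (auto simp: map_comp_def split: option.splits)
    then have "Pow (dom (g \<circ>\<^sub>m f)) \<subseteq> Pow (dom f)" by blast
    then show ?thesis
      using finite_dom_Mor_EO[OF f] by (intro sum.mono_neutral_cong_right) simp_all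
  qed
  finally show ?thesis by simp
qed

lemma restriction_sum_conv:
  assumes a: "Poly_Mapping.keys a \<subseteq> Mor (EO n)" and b: "Poly_Mapping.keys b \<subseteq> Mor (EO n)"
  shows "restriction_sum (conv (\<lambda>_ _. True) (\<circ>\<^sub>m) a b) =
    conv (composable (EO n)) (\<circ>\<^sub>m) (restriction_sum a) (restriction_sum b)"
proof -
  have single: "restriction_sum (conv (\<lambda>_ _. True) (\<circ>\<^sub>m) (Poly_Mapping.single g c) b) =
    conv (composable (EO n)) (\<circ>\<^sub>m) (restriction_sum (Poly_Mapping.single g c)) (restriction_sum b)"
    if "g \<in> Mor (EO n)" for g c
    using b
  proof (induction b rule: poly_mapping_induct_on)
    case (single f d)
    show ?case using restriction_sum_comp[OF that single, of c d] by simp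
  qed (simp_all only: conv_add_right restriction_sum_add conv_zero restriction_sum_zero)
  show ?thesis
    using a by (induction a rule: poly_mapping_induct_on)
      (simp_all only: conv_add_left restriction_sum_add conv_zero restriction_sum_zero single)
qed

lemma ring_iso_restriction_sum:
  "restriction_sum \<in> ring_iso (monoid_algebra (PO n)) (category_algebra (EO n) :: ('k::field, _ \<Rightarrow>\<^sub>0 'k) module)"
proof (rule ring_iso_memI)
  let ?P = "monoid_algebra (PO n) :: ('k, _ \<Rightarrow>\<^sub>0 'k) module"
  let ?E = "category_algebra (EO n) :: ('k, _ \<Rightarrow>\<^sub>0 'k) module"
  have carrier: "carrier ?P = span_on (Mor (EO n))" "carrier ?E = span_on (Mor (EO n))"
    by (simp_all add: monoid_algebra_simps category_algebra_simps carrier_PO)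
  show closed: "restriction_sum a \<in> carrier ?E" if "a \<in> carrier ?P" for a
    using that keys_restriction_sum unfolding carrier by blast
  show "restriction_sum (a \<otimes>\<^bsub>?P\<^esub> b) = restriction_sum a \<otimes>\<^bsub>?E\<^esub> restriction_sum b"
    if "a \<in> carrier ?P" "b \<in> carrier ?P" for a b
  proof -
    have "mult (PO n) = (\<circ>\<^sub>m)" by (simp add: PO_def)
    then show ?thesis
      using that restriction_sum_conv[of a n b]
      unfolding carrier by (simp add: monoid_algebra_simps category_algebra_simps)
  qed
  show "restriction_sum (a \<oplus>\<^bsub>?P\<^esub> b) = restriction_sum a \<oplus>\<^bsub>?E\<^esub> restriction_sum b" for a b
    by (simp add: monoid_algebra_simps category_algebra_simps restriction_sum_add)
  have "\<one>\<^bsub>PO n\<^esub> = Some |` {1..n}" by (simp add: PO_def)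
  \<comment> \<open>The restrictions of the identity of \<open>{1..n}\<close> are the identities of
    all objects, and their sum is the unit of the category algebra.\<close>
  then show "restriction_sum \<one>\<^bsub>?P\<^esub> = \<one>\<^bsub>?E\<^esub>"
    by (auto simp: monoid_algebra_simps category_algebra_simps dom_id Int_absorb1 intro!: sum.cong)
  show "bij_betw restriction_sum (carrier ?P) (carrier ?E)"
    unfolding bij_betw_def
  proof
    show "inj_on restriction_sum (carrier ?P)"
    proof (rule inj_onI)
      fix a b assume ab: "a \<in> carrier ?P" "b \<in> carrier ?P" "restriction_sum a = restriction_sum b"
      then have "Poly_Mapping.keys (a - b) \<subseteq> Mor (EO n)"
        using keys_diff[of a b] unfolding carrier by blast
      then have "finite (dom f)" if "f \<in> Poly_Mapping.keys (a - b)" for f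
        using that finite_dom_Mor_EO by blast
      then have "a - b = 0"
        by (rule restriction_sum_eq_zero) (simp_all add: restriction_sum_diff ab(3))
      then show "a = b" by simp
    qed
    have "b \<in> restriction_sum ` carrier ?P" if "b \<in> carrier ?E" for b
    proof -
      from that have "Poly_Mapping.keys b \<subseteq> Mor (EO n)" unfolding carrier by simp
      then show ?thesis
      proof (induction b rule: poly_mapping_induct_on)
        case zero
        have "0 \<in> carrier ?P" by (simp add: carrier)
        then show ?case using restriction_sum_zero by (metis imageI)
      next
        case (single f c)
        then show ?case
          using single_in_range_restriction_sum unfolding carrier by blast
      next
        case (add a b)
        then obtain a' b' where ab: "a' \<in> carrier ?P" "a = restriction_sum a'"
          "b' \<in> carrier ?P" "b = restriction_sum b'" by blast
        then have "a' + b' \<in> carrier ?P" unfolding carrier using keys_add[of a' b'] by blast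
        then show ?case
          unfolding ab(2,4) restriction_sum_add[symmetric] by blast
      qed
    qed
    then show "restriction_sum ` carrier ?P = carrier ?E" using closed by blast
  qed
qed

theorem corollary4p2:
  fixes n :: nat
  assumes "n \<ge> 1"
  shows "loewy_length (category_algebra (EO n) :: ('k::field, (nat \<rightharpoonup> nat) \<Rightarrow>\<^sub>0 'k) module) = n \<and>
         loewy_length (monoid_algebra (PO n) :: ('k, (nat \<rightharpoonup> nat) \<Rightarrow>\<^sub>0 'k) module) = n"
proof -
  have "ring_isomorphism (monoid_algebra (PO n) :: ('k, (nat \<rightharpoonup> nat) \<Rightarrow>\<^sub>0 'k) module)
      (category_algebra (EO n)) restriction_sum"
    by (intro ring_isomorphism.intro ring_monoid_algebra monoid_PO ring_EO ring_iso_restriction_sum)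
  from ring_isomorphism.loewy_length_eq[OF this] show ?thesis
    using loewy_length_EO[OF assms, where 'k = 'k] by simp
qed

end
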